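(* Let $L$ be any of the fifteen logics of the modal cube and $\mathcal M_L$ its Nmatrix. For every set of formulas $\Gamma$ and formula $\alpha$, if $\Gamma\vdash_L\alpha$ then $\Gamma\models^{\mathcal M_L}\alpha$.
   Context: Syntax and logics. Formulas: $\alpha ::= p \mid \bot \mid \alpha\to\alpha \mid \Box\alpha$ ($p$ in a countable set of propositional variables); $\mathrm{For}$ is the set of formulas; $\neg\alpha:=\alpha\to\bot$, $\Diamond\alpha:=\neg\Box\neg\alpha$, $\wedge,\vee$ the usual classical abbreviations. $\mathbf K$ is axiomatized by classical propositional axioms, (k) $\Box(\alpha\to\beta)\to(\Box\alpha\to\Box\beta)$, modus ponens and necessitation (from $\alpha$ infer $\Box\alpha$). Axiom schemes: (D) $\Box\alpha\to\Diamond\alpha$, (T) $\Box\alpha\to\alpha$, (B) $\alpha\to\Box\Diamond\alpha$, (4) $\Box\alpha\to\Box\Box\alpha$, (5) $\Diamond\alpha\to\Box\Diamond\alpha$. The modal cube: $\mathbf K,\mathbf{KB},\mathbf{K4},\mathbf{K5},\mathbf{K45},\mathbf{KD},\mathbf{KDB},\mathbf{KD4},\mathbf{KD5},\mathbf{KD45},\mathbf{KT},\mathbf{KTB},\mathbf{S4}=\mathbf{KT4},\mathbf{S5}=\mathbf{KTB45},\mathbf{KB5}=\mathbf{KB45}$, each $\mathbf K$ plus the named schemes. $\Gamma\vdash_L\alpha$ means $\alpha$ is a theorem of $L$ or $(\gamma_1\wedge\dots\wedge\gamma_k)\to\alpha$ is a theorem of $L$ for some $\gamma_i\in\Gamma$.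 Truth values: $\mathbf{F},\mathbf{f},\mathbf{f}_2,\mathbf{f}_3,\mathbf{t}_3,\mathbf{t}_2,\mathbf{t},\mathbf{T}$; designated set $\mathcal D=\{\mathbf T,\mathbf t,\mathbf t_2,\mathbf t_3\}$. Nmatrix $\mathcal M_L$. Values $V(L)$: all eight values for $L\in\{\mathbf K,\mathbf{KB},\mathbf{K4},\mathbf{K5},\mathbf{K45}\}$; $\{\mathbf F,\mathbf f,\mathbf f_2,\mathbf t_2,\mathbf t,\mathbf T\}$ for $\mathbf{KB5}$; $\{\mathbf F,\mathbf f,\mathbf f_3,\mathbf t_3,\mathbf t,\mathbf T\}$ for $L\in\{\mathbf{KD},\mathbf{KDB},\mathbf{KD4},\mathbf{KD5},\mathbf{KD45}\}$; $\{\mathbf F,\mathbf f,\mathbf t,\mathbf T\}$ for $L\in\{\mathbf{KT},\mathbf{KTB},\mathbf{S4},\mathbf{S5}\}$. Designated values $V(L)\cap\mathcal D$. Non-deterministic truth functions: $\tilde\bot=\{\mathbf F,\mathbf f_2\}$; $\tilde\to(x,y)$ is given by the following table, restricted to arguments in $V(L)$ (listing, for each $x$, the values for $y=\mathbf F,\mathbf f,\mathbf f_2,\mathbf f_3,\mathbf t_3,\mathbf t_2,\mathbf t,\mathbf T$ in this order): $x=\mathbf F$: $\{\mathbf T\}$ for every $y$; $x=\mathbf f$: $\{\mathbf t\},\{\mathbf T,\mathbf t\},\{\mathbf t_2\},\{\mathbf T\},\{\mathbf t\},\{\mathbf T\},\{\mathbf T,\mathbf t\},\{\mathbf T\}$;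 $x=\mathbf f_2$: $\{\mathbf t_3\},\{\mathbf t\},\{\mathbf t_2\},\{\mathbf T\},\{\mathbf t_3\},\{\mathbf t_2\},\{\mathbf t\},\{\mathbf T\}$; $x=\mathbf f_3$: $\{\mathbf t_3\},\{\mathbf t\},\{\mathbf t_2\},\{\mathbf T\},\{\mathbf t_3\},\{\mathbf t_2\},\{\mathbf t\},\{\mathbf T\}$; $x=\mathbf t_3$: $\{\mathbf f_3\},\{\mathbf f_3\},\{\mathbf f_3\},\{\mathbf f_3\},\{\mathbf T\},\{\mathbf T\},\{\mathbf T\},\{\mathbf T\}$; $x=\mathbf t_2$: $\{\mathbf F\},\{\mathbf f\},\{\mathbf f_2\},\{\mathbf f_3\},\{\mathbf t_3\},\{\mathbf t_2\},\{\mathbf t_3\},\{\mathbf T\}$; $x=\mathbf t$: $\{\mathbf f\},\{\mathbf f,\mathbf f_3\},\{\mathbf f_3\},\{\mathbf f_3\},\{\mathbf t\},\{\mathbf T\},\{\mathbf T,\mathbf t\},\{\mathbf T\}$; $x=\mathbf T$: $\{\mathbf F\},\{\mathbf f\},\{\mathbf f_2\},\{\mathbf f_3\},\{\mathbf t_3\},\{\mathbf t_2\},\{\mathbf t\},\{\mathbf T\}$. $\tilde\Box$ (listed as argument $\mapsto$ output): $\mathbf K$: $\mathbf F,\mathbf f,\mathbf t_3,\mathbf t\mapsto\{\mathbf F,\mathbf f,\mathbf f_3\}$; $\mathbf f_2,\mathbf t_2\mapsto\{\mathbf t_2\}$; $\mathbf f_3,\mathbf T\mapsto\{\mathbf T,\mathbf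 t,\mathbf t_3\}$. $\mathbf{KB}$: $\mathbf F,\mathbf f\mapsto\{\mathbf F\}$; $\mathbf f_2,\mathbf t_2\mapsto\{\mathbf t_2\}$; $\mathbf f_3\mapsto\{\mathbf t_3\}$; $\mathbf t_3,\mathbf t\mapsto\{\mathbf F,\mathbf f,\mathbf f_3\}$; $\mathbf T\mapsto\{\mathbf T,\mathbf t,\mathbf t_3\}$. $\mathbf{K4}$: $\mathbf F,\mathbf f,\mathbf t_3,\mathbf t\mapsto\{\mathbf F,\mathbf f,\mathbf f_3\}$; $\mathbf f_2,\mathbf t_2\mapsto\{\mathbf t_2\}$; $\mathbf f_3,\mathbf T\mapsto\{\mathbf T\}$. $\mathbf{K5}$: $\mathbf F,\mathbf f,\mathbf t_3,\mathbf t\mapsto\{\mathbf F\}$; $\mathbf f_2,\mathbf t_2\mapsto\{\mathbf t_2\}$; $\mathbf f_3,\mathbf T\mapsto\{\mathbf T,\mathbf t_3\}$. $\mathbf{K45}$: $\mathbf F,\mathbf f,\mathbf t_3,\mathbf t\mapsto\{\mathbf F\}$; $\mathbf f_2,\mathbf t_2\mapsto\{\mathbf t_2\}$; $\mathbf f_3,\mathbf T\mapsto\{\mathbf T\}$. $\mathbf{KB5}$: $\mathbf F,\mathbf f,\mathbf t\mapsto\{\mathbf F\}$; $\mathbf f_2,\mathbf t_2\mapsto\{\mathbf t_2\}$; $\mathbf T\mapsto\{\mathbf T\}$. $\mathbf{KD}$: $\mathbf F,\mathbf f,\mathbf t_3,\mathbf t\mapsto\{\mathbf F,\mathbf f,\mathbf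 f_3\}$; $\mathbf f_3,\mathbf T\mapsto\{\mathbf T,\mathbf t,\mathbf t_3\}$. $\mathbf{KDB}$: $\mathbf F,\mathbf f\mapsto\{\mathbf F\}$; $\mathbf f_3\mapsto\{\mathbf t_3\}$; $\mathbf t_3,\mathbf t\mapsto\{\mathbf F,\mathbf f,\mathbf f_3\}$; $\mathbf T\mapsto\{\mathbf T,\mathbf t,\mathbf t_3\}$. $\mathbf{KD4}$: $\mathbf F,\mathbf t_3\mapsto\{\mathbf F\}$; $\mathbf f,\mathbf t\mapsto\{\mathbf F,\mathbf f,\mathbf f_3\}$; $\mathbf f_3,\mathbf T\mapsto\{\mathbf T\}$. $\mathbf{KD5}$: $\mathbf F,\mathbf f,\mathbf t_3,\mathbf t\mapsto\{\mathbf F\}$; $\mathbf f_3,\mathbf T\mapsto\{\mathbf T,\mathbf t_3\}$. $\mathbf{KD45}$: $\mathbf F,\mathbf f,\mathbf t_3,\mathbf t\mapsto\{\mathbf F\}$; $\mathbf f_3,\mathbf T\mapsto\{\mathbf T\}$. $\mathbf{KT}$: $\mathbf F\mapsto\{\mathbf F\}$; $\mathbf f,\mathbf t\mapsto\{\mathbf F,\mathbf f\}$; $\mathbf T\mapsto\{\mathbf T,\mathbf t\}$. $\mathbf{KTB}$: $\mathbf F,\mathbf f\mapsto\{\mathbf F\}$; $\mathbf t\mapsto\{\mathbf F,\mathbf f\}$; $\mathbf T\mapsto\{\mathbf T,\mathbf t\}$. $\mathbf{S4}$: $\mathbf F\mapsto\{\mathbf F\}$; $\mathbf f,\mathbf t\mapsto\{\mathbf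 F,\mathbf f\}$; $\mathbf T\mapsto\{\mathbf T\}$. $\mathbf{S5}$: $\mathbf F,\mathbf f,\mathbf t\mapsto\{\mathbf F\}$; $\mathbf T\mapsto\{\mathbf T\}$. A valuation in $\mathcal M_L$ is a map $v:\mathrm{For}\to V(L)$ with $v(\bot)\in\tilde\bot$, $v(\alpha\to\beta)\in\tilde\to(v(\alpha),v(\beta))$ and $v(\Box\alpha)\in\tilde\Box(v(\alpha))$; $\mathrm{Val}(\mathcal M_L)$ is the set of valuations. Level valuations: $L_0(\mathcal M_L)$ is the set of $v\in\mathrm{Val}(\mathcal M_L)$ such that, if $v(\alpha)\in\{\mathbf f_2,\mathbf t_2\}$ for some $\alpha$, then $v(\beta)\in\{\mathbf f_2,\mathbf t_2\}$ for all $\beta$. $L_{n+1}(\mathcal M_L)=\{v\in L_n(\mathcal M_L)\mid$ for all $\alpha$, if $w(\alpha)\in\mathcal D$ for every $w\in L_n(\mathcal M_L)$, then $v(\alpha)\in\{\mathbf T,\mathbf t_2\}\}$. The set of level-valuations is $L(\mathcal M_L)=\bigcap_{n\ge0}L_n(\mathcal M_L)$. $\Gamma\models^{\mathcal M_L}\alpha$ means: for every $v\in L(\mathcal M_L)$, if $v(\beta)\in\mathcal D$ for all $\beta\in\Gamma$, then $v(\alpha)\in\mathcal D$. *)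

theory Defs
  imports Main "HOL-Library.Countable"
begin

section \<open>Syntax\<close>

datatype 'p fm =
    Var 'p
  | Bot (\<open>\<^bold>\<bottom>\<close>)
  | Imp "'p fm" "'p fm" (infixr \<open>\<^bold>\<rightarrow>\<close> 55)
  | Box "'p fm" (\<open>\<^bold>\<box>_\<close> [70] 70)

abbreviation Neg :: "'p fm \<Rightarrow> 'p fm" (\<open>\<^bold>\<not>_\<close> [70] 70) where
  "\<^bold>\<not>\<alpha> \<equiv> \<alpha> \<^bold>\<rightarrow> \<^bold>\<bottom>"

abbreviation Dia :: "'p fm \<Rightarrow> 'p fm" (\<open>\<^bold>\<diamond>_\<close> [70] 70) where
  "\<^bold>\<diamond>\<alpha> \<equiv> \<^bold>\<not>\<^bold>\<box>\<^bold>\<not>\<alpha>"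

abbreviation And :: "'p fm \<Rightarrow> 'p fm \<Rightarrow> 'p fm" (infixr \<open>\<^bold>\<and>\<close> 65) where
  "\<alpha> \<^bold>\<and> \<beta> \<equiv> \<^bold>\<not>(\<alpha> \<^bold>\<rightarrow> \<^bold>\<not>\<beta>)"

text \<open>Only used on nonempty lists; the value on the empty list is irrelevant.\<close>

fun BigAnd :: "'p fm list \<Rightarrow> 'p fm" where
  "BigAnd [] = \<^bold>\<not>\<^bold>\<bottom>"
| "BigAnd [\<alpha>] = \<alpha>"
| "BigAnd (\<alpha> # \<beta> # \<gamma>s) = \<alpha> \<^bold>\<and> BigAnd (\<beta> # \<gamma>s)"


section \<open>The fifteen Hilbert systems of the modal cube\<close>

datatype scheme = AxD | AxT | AxB | Ax4 | Ax5

datatype logic =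
    K | KB | K4 | K5 | K45 | KB5
  | KD | KDB | KD4 | KD5 | KD45
  | KT | KTB | S4 | S5

fun scheme_inst :: "scheme \<Rightarrow> 'p fm \<Rightarrow> 'p fm" where
  "scheme_inst AxD \<alpha> = (\<^bold>\<box>\<alpha> \<^bold>\<rightarrow> \<^bold>\<diamond>\<alpha>)"
| "scheme_inst AxT \<alpha> = (\<^bold>\<box>\<alpha> \<^bold>\<rightarrow> \<alpha>)"
| "scheme_inst AxB \<alpha> = (\<alpha> \<^bold>\<rightarrow> \<^bold>\<box>\<^bold>\<diamond>\<alpha>)"
| "scheme_inst Ax4 \<alpha> = (\<^bold>\<box>\<alpha> \<^bold>\<rightarrow> \<^bold>\<box>\<^bold>\<box>\<alpha>)"
| "scheme_inst Ax5 \<alpha> = (\<^bold>\<diamond>\<alpha> \<^bold>\<rightarrow> \<^bold>\<box>\<^bold>\<diamond>\<alpha>)"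

fun schemes :: "logic \<Rightarrow> scheme set" where
  "schemes K = {}"
| "schemes KB = {AxB}"
| "schemes K4 = {Ax4}"
| "schemes K5 = {Ax5}"
| "schemes K45 = {Ax4, Ax5}"
| "schemes KB5 = {AxB, Ax4, Ax5}"
| "schemes KD = {AxD}"
| "schemes KDB = {AxD, AxB}"
| "schemes KD4 = {AxD, Ax4}"
| "schemes KD5 = {AxD, Ax5}"
| "schemes KD45 = {AxD, Ax4, Ax5}"
| "schemes KT = {AxT}"
| "schemes KTB = {AxT, AxB}"
| "schemes S4 = {AxT, Ax4}"
| "schemes S5 = {AxT, AxB, Ax4, Ax5}"

text \<open>The first three clauses axiomatize classical propositional logic over
  implication and falsum.\<close>

inductive thm_of :: "logic \<Rightarrow> 'p fm \<Rightarrow> bool" for L :: logic where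
  Ax_weak: "thm_of L (\<alpha> \<^bold>\<rightarrow> (\<beta> \<^bold>\<rightarrow> \<alpha>))"
| Ax_dist: "thm_of L ((\<alpha> \<^bold>\<rightarrow> (\<beta> \<^bold>\<rightarrow> \<gamma>)) \<^bold>\<rightarrow> ((\<alpha> \<^bold>\<rightarrow> \<beta>) \<^bold>\<rightarrow> (\<alpha> \<^bold>\<rightarrow> \<gamma>)))"
| Ax_dneg: "thm_of L (\<^bold>\<not>\<^bold>\<not>\<alpha> \<^bold>\<rightarrow> \<alpha>)"
| Ax_k: "thm_of L (\<^bold>\<box>(\<alpha> \<^bold>\<rightarrow> \<beta>) \<^bold>\<rightarrow> (\<^bold>\<box>\<alpha> \<^bold>\<rightarrow> \<^bold>\<box>\<beta>))"
| Ax_scheme: "s \<in> schemes L \<Longrightarrow> thm_of L (scheme_inst s \<alpha>)"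
| MP: "thm_of L (\<alpha> \<^bold>\<rightarrow> \<beta>) \<Longrightarrow> thm_of L \<alpha> \<Longrightarrow> thm_of L \<beta>"
| Nec: "thm_of L \<alpha> \<Longrightarrow> thm_of L (\<^bold>\<box>\<alpha>)"

definition derives :: "logic \<Rightarrow> 'p fm set \<Rightarrow> 'p fm \<Rightarrow> bool" where
  "derives L \<Gamma> \<alpha> \<longleftrightarrow>
     thm_of L \<alpha> \<or>
     (\<exists>\<gamma>s. \<gamma>s \<noteq> [] \<and> set \<gamma>s \<subseteq> \<Gamma> \<and> thm_of L (BigAnd \<gamma>s \<^bold>\<rightarrow> \<alpha>))"


section \<open>The Nmatrices\<close>

datatype tv = VF | Vf | Vf2 | Vf3 | Vt3 | Vt2 | Vt | VT

definition designated :: "tv set" where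
  "designated = {VT, Vt, Vt2, Vt3}"

fun vals :: "logic \<Rightarrow> tv set" where
  "vals K = UNIV"
| "vals KB = UNIV"
| "vals K4 = UNIV"
| "vals K5 = UNIV"
| "vals K45 = UNIV"
| "vals KB5 = {VF, Vf, Vf2, Vt2, Vt, VT}"
| "vals KD = {VF, Vf, Vf3, Vt3, Vt, VT}"
| "vals KDB = {VF, Vf, Vf3, Vt3, Vt, VT}"
| "vals KD4 = {VF, Vf, Vf3, Vt3, Vt, VT}"
| "vals KD5 = {VF, Vf, Vf3, Vt3, Vt, VT}"
| "vals KD45 = {VF, Vf, Vf3, Vt3, Vt, VT}"
| "vals KT = {VF, Vf, Vt, VT}"
| "vals KTB = {VF, Vf, Vt, VT}"
| "vals S4 = {VF, Vf, Vt, VT}"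
| "vals S5 = {VF, Vf, Vt, VT}"

text \<open>The tables for falsum and implication are shared by all fifteen Nmatrices and
  may mention values outside \<open>vals L\<close>; these are discarded because a valuation
  takes all its values in \<open>vals L\<close>.\<close>

definition nbot :: "tv set" where
  "nbot = {VF, Vf2}"

fun nimp :: "tv \<Rightarrow> tv \<Rightarrow> tv set" where
  "nimp VF y = {VT}"
| "nimp Vf y = (case y of
     VF \<Rightarrow> {Vt} | Vf \<Rightarrow> {VT, Vt} | Vf2 \<Rightarrow> {Vt2} | Vf3 \<Rightarrow> {VT}
   | Vt3 \<Rightarrow> {Vt} | Vt2 \<Rightarrow> {VT} | Vt \<Rightarrow> {VT, Vt} | VT \<Rightarrow> {VT})"
| "nimp Vf2 y = (case y of
     VF \<Rightarrow> {Vt3} | Vf \<Rightarrow> {Vt} | Vf2 \<Rightarrow> {Vt2} | Vf3 \<Rightarrow> {VT}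
   | Vt3 \<Rightarrow> {Vt3} | Vt2 \<Rightarrow> {Vt2} | Vt \<Rightarrow> {Vt} | VT \<Rightarrow> {VT})"
| "nimp Vf3 y = (case y of
     VF \<Rightarrow> {Vt3} | Vf \<Rightarrow> {Vt} | Vf2 \<Rightarrow> {Vt2} | Vf3 \<Rightarrow> {VT}
   | Vt3 \<Rightarrow> {Vt3} | Vt2 \<Rightarrow> {Vt2} | Vt \<Rightarrow> {Vt} | VT \<Rightarrow> {VT})"
| "nimp Vt3 y = (case y of
     VF \<Rightarrow> {Vf3} | Vf \<Rightarrow> {Vf3} | Vf2 \<Rightarrow> {Vf3} | Vf3 \<Rightarrow> {Vf3}
   | Vt3 \<Rightarrow> {VT} | Vt2 \<Rightarrow> {VT} | Vt \<Rightarrow> {VT} | VT \<Rightarrow> {VT})"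
| "nimp Vt2 y = (case y of
     VF \<Rightarrow> {VF} | Vf \<Rightarrow> {Vf} | Vf2 \<Rightarrow> {Vf2} | Vf3 \<Rightarrow> {Vf3}
   | Vt3 \<Rightarrow> {Vt3} | Vt2 \<Rightarrow> {Vt2} | Vt \<Rightarrow> {Vt3} | VT \<Rightarrow> {VT})"
| "nimp Vt y = (case y of
     VF \<Rightarrow> {Vf} | Vf \<Rightarrow> {Vf, Vf3} | Vf2 \<Rightarrow> {Vf3} | Vf3 \<Rightarrow> {Vf3}
   | Vt3 \<Rightarrow> {Vt} | Vt2 \<Rightarrow> {VT} | Vt \<Rightarrow> {VT, Vt} | VT \<Rightarrow> {VT})"
| "nimp VT y = (case y of
     VF \<Rightarrow> {VF} | Vf \<Rightarrow> {Vf} | Vf2 \<Rightarrow> {Vf2} | Vf3 \<Rightarrow> {Vf3}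
   | Vt3 \<Rightarrow> {Vt3} | Vt2 \<Rightarrow> {Vt2} | Vt \<Rightarrow> {Vt} | VT \<Rightarrow> {VT})"

text \<open>The final \<open>{}\<close> is reached only for arguments outside \<open>vals L\<close>.\<close>

fun nbox :: "logic \<Rightarrow> tv \<Rightarrow> tv set" where
  "nbox K x =
    (if x \<in> {VF, Vf, Vt3, Vt} then {VF, Vf, Vf3}
     else if x \<in> {Vf2, Vt2} then {Vt2}
     else if x \<in> {Vf3, VT} then {VT, Vt, Vt3}
     else {})"
| "nbox KB x =
    (if x \<in> {VF, Vf} then {VF}
     else if x \<in> {Vf2, Vt2} then {Vt2}
     else if x = Vf3 then {Vt3}
     else if x \<in> {Vt3, Vt} then {VF, Vf, Vf3}
     else if x = VT then {VT, Vt, Vt3}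
     else {})"
| "nbox K4 x =
    (if x \<in> {VF, Vf, Vt3, Vt} then {VF, Vf, Vf3}
     else if x \<in> {Vf2, Vt2} then {Vt2}
     else if x \<in> {Vf3, VT} then {VT}
     else {})"
| "nbox K5 x =
    (if x \<in> {VF, Vf, Vt3, Vt} then {VF}
     else if x \<in> {Vf2, Vt2} then {Vt2}
     else if x \<in> {Vf3, VT} then {VT, Vt3}
     else {})"
| "nbox K45 x =
    (if x \<in> {VF, Vf, Vt3, Vt} then {VF}
     else if x \<in> {Vf2, Vt2} then {Vt2}
     else if x \<in> {Vf3, VT} then {VT}
     else {})"
| "nbox KB5 x =
    (if x \<in> {VF, Vf, Vt} then {VF}
     else if x \<in> {Vf2, Vt2} then {Vt2}
     else if x = VT then {VT}
     else {})"
| "nbox KD x =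
    (if x \<in> {VF, Vf, Vt3, Vt} then {VF, Vf, Vf3}
     else if x \<in> {Vf3, VT} then {VT, Vt, Vt3}
     else {})"
| "nbox KDB x =
    (if x \<in> {VF, Vf} then {VF}
     else if x = Vf3 then {Vt3}
     else if x \<in> {Vt3, Vt} then {VF, Vf, Vf3}
     else if x = VT then {VT, Vt, Vt3}
     else {})"
| "nbox KD4 x =
    (if x \<in> {VF, Vt3} then {VF}
     else if x \<in> {Vf, Vt} then {VF, Vf, Vf3}
     else if x \<in> {Vf3, VT} then {VT}
     else {})"
| "nbox KD5 x =
    (if x \<in> {VF, Vf, Vt3, Vt} then {VF}
     else if x \<in> {Vf3, VT} then {VT, Vt3}
     else {})"
| "nbox KD45 x =
    (if x \<in> {VF, Vf, Vt3, Vt} then {VF}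
     else if x \<in> {Vf3, VT} then {VT}
     else {})"
| "nbox KT x =
    (if x = VF then {VF}
     else if x \<in> {Vf, Vt} then {VF, Vf}
     else if x = VT then {VT, Vt}
     else {})"
| "nbox KTB x =
    (if x \<in> {VF, Vf} then {VF}
     else if x = Vt then {VF, Vf}
     else if x = VT then {VT, Vt}
     else {})"
| "nbox S4 x =
    (if x = VF then {VF}
     else if x \<in> {Vf, Vt} then {VF, Vf}
     else if x = VT then {VT}
     else {})"
| "nbox S5 x =
    (if x \<in> {VF, Vf, Vt} then {VF}
     else if x = VT then {VT}
     else {})"

definition Val :: "logic \<Rightarrow> ('p fm \<Rightarrow> tv) set" where
  "Val L = {v.
     (\<forall>\<alpha>. v \<alpha> \<in> vals L) \<and>
     v \<^bold>\<bottom> \<in> nbot \<and>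
     (\<forall>\<alpha> \<beta>. v (\<alpha> \<^bold>\<rightarrow> \<beta>) \<in> nimp (v \<alpha>) (v \<beta>)) \<and>
     (\<forall>\<alpha>. v (\<^bold>\<box>\<alpha>) \<in> nbox L (v \<alpha>))}"


section \<open>Level valuations and consequence\<close>

primrec levels :: "logic \<Rightarrow> nat \<Rightarrow> ('p fm \<Rightarrow> tv) set" where
  "levels L 0 =
     {v \<in> Val L. (\<exists>\<alpha>. v \<alpha> \<in> {Vf2, Vt2}) \<longrightarrow> (\<forall>\<beta>. v \<beta> \<in> {Vf2, Vt2})}"
| "levels L (Suc n) =
     {v \<in> levels L n.
        \<forall>\<alpha>. (\<forall>w \<in> levels L n. w \<alpha> \<in> designated) \<longrightarrow> v \<alpha> \<in> {VT, Vt2}}"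

definition level_vals :: "logic \<Rightarrow> ('p fm \<Rightarrow> tv) set" where
  "level_vals L = (\<Inter>n. levels L n)"

definition entails :: "logic \<Rightarrow> 'p fm set \<Rightarrow> 'p fm \<Rightarrow> bool" where
  "entails L \<Gamma> \<alpha> \<longleftrightarrow>
     (\<forall>v \<in> level_vals L. (\<forall>\<beta> \<in> \<Gamma>. v \<beta> \<in> designated) \<longrightarrow> v \<alpha> \<in> designated)"

end

theory Submission imports Defs begin

text \<open>Every axiom instance is designated in all level-0 valuations, and modus ponens preserves
  designation. Hence each theorem is designated throughout some \<open>levels L n\<close>, where \<open>n\<close> counts
  the nested applications of necessitation: \<open>levels L (Suc n)\<close> forces its value into
  \<open>{VT, Vt2}\<close>, so its box is designated there.\<close>

text \<open>The values of formulas \<open>\<alpha>\<close> whose box is designated.\<close>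

definition necessary :: "tv set" where
  "necessary = {VT, Vt2, Vf2, Vf3}"

text \<open>Each cell of \<open>nimp\<close> lies entirely inside or entirely outside
  \<open>designated\<close>, as the classical truth table prescribes.\<close>

lemma designated_imp_iff:
  assumes "v \<in> Val L"
  shows "v (\<alpha> \<^bold>\<rightarrow> \<beta>) \<in> designated \<longleftrightarrow> (v \<alpha> \<in> designated \<longrightarrow> v \<beta> \<in> designated)"
proof -
  have "v (\<alpha> \<^bold>\<rightarrow> \<beta>) \<in> nimp (v \<alpha>) (v \<beta>)"
    using assms by (simp add: Val_def)
  then show ?thesis
    by (cases "v \<alpha>"; cases "v \<beta>") (auto simp: designated_def)
qed

lemma not_designated_bot:
  assumes "v \<in> Val L"
  shows "v \<^bold>\<bottom> \<notin> designated"
  using assms by (auto simp: Val_def nbot_def designated_def)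

text \<open>The fifteen tables agree on which arguments have a designated box; arguments with an
  empty entry are vacuous.\<close>

lemma designated_nbox_iff: "y \<in> nbox L x \<Longrightarrow> y \<in> designated \<longleftrightarrow> x \<in> necessary"
  by (cases L; cases x) (auto simp: designated_def necessary_def)

lemma designated_box_iff:
  "v \<in> Val L \<Longrightarrow> v (\<^bold>\<box>\<alpha>) \<in> designated \<longleftrightarrow> v \<alpha> \<in> necessary"
  by (rule designated_nbox_iff[of _ L]) (simp add: Val_def)

lemma levels_zero_Val: "v \<in> levels L 0 \<Longrightarrow> v \<in> Val L"
  by simp

text \<open>The set \<open>necessary\<close> is closed under modus ponens: for an antecedent in it,
  \<open>nimp\<close> yields a value in it only if the consequent is in it.\<close>

lemma designated_k:
  assumes v: "v \<in> levels L 0"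
  shows "v (\<^bold>\<box>(\<alpha> \<^bold>\<rightarrow> \<beta>) \<^bold>\<rightarrow> (\<^bold>\<box>\<alpha> \<^bold>\<rightarrow> \<^bold>\<box>\<beta>)) \<in> designated"
proof -
  have V: "v \<in> Val L"
    using v by (rule levels_zero_Val)
  have "v (\<alpha> \<^bold>\<rightarrow> \<beta>) \<in> nimp (v \<alpha>) (v \<beta>)"
    using V by (simp add: Val_def)
  then have "v (\<alpha> \<^bold>\<rightarrow> \<beta>) \<in> necessary \<Longrightarrow> v \<alpha> \<in> necessary \<Longrightarrow> v \<beta> \<in> necessary"
    using v by (cases "v \<alpha>"; cases "v \<beta>") (auto simp: necessary_def)
  then show ?thesis
    by (simp add: designated_imp_iff[OF V] designated_box_iff[OF V])
qed

text \<open>Collapsed valuations behave like worlds without successors, where everything is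
  vacuously necessary. Otherwise \<open>Vf2\<close> is barred, which leaves only \<open>VF\<close>
  for falsum.\<close>

lemma levels_zero_cases:
  assumes v: "v \<in> levels L 0"
  obtains (collapsed) "\<And>\<beta>. v \<beta> \<in> {Vf2, Vt2}"
  | (regular) "\<And>\<beta>. v \<beta> \<notin> {Vf2, Vt2}" "v \<^bold>\<bottom> = VF"
proof (cases "\<exists>\<alpha>. v \<alpha> \<in> {Vf2, Vt2}")
  case True
  then show ?thesis
    using v collapsed by simp
next
  case False
  then show ?thesis
    using regular levels_zero_Val[OF v] by (auto simp: Val_def nbot_def)
qed

lemma necessary_if_collapsed:
  "x \<in> {Vf2, Vt2} \<Longrightarrow> x \<in> necessary"
  by (auto simp: necessary_def)

text \<open>Collapsed valuations refute D and T; the logics with one of these schemes are exactly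
  those whose \<open>vals L\<close> omits \<open>Vf2\<close> and \<open>Vt2\<close>.\<close>

lemma collapsed_vals: "v \<in> Val L \<Longrightarrow> v \<alpha> \<in> {Vf2, Vt2} \<Longrightarrow> schemes L \<inter> {AxD, AxT} = {}"
  by (cases L) (auto simp: Val_def dest!: spec[of _ \<alpha>])

text \<open>For axiom D: only \<open>VT\<close> and \<open>Vf3\<close> remain for \<open>x\<close>,
  and their negations are \<open>VF\<close> and \<open>Vt3\<close>.\<close>

lemma not_necessary_neg:
  assumes "x \<notin> {Vf2, Vt2}" "y \<in> nimp x VF" "x \<in> necessary"
  shows "y \<notin> necessary"
  using assms by (cases x) (auto simp: necessary_def)

text \<open>For axiom T: \<open>vals L\<close> is then four-valued, and \<open>VT\<close> is its
  only necessary value.\<close>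

lemma designated_if_necessary:
  assumes "AxT \<in> schemes L" "x \<in> vals L" "x \<in> necessary"
  shows "x \<in> designated"
  using assms by (cases L) (auto simp: necessary_def designated_def)

text \<open>For axiom B: \<open>x\<close>, \<open>y\<close>, \<open>b\<close>, \<open>c\<close>
  stand for the values of \<alpha>, its negation, the box of that negation, and the diamond of
  \<alpha>.\<close>

lemma necessary_dia:
  assumes "AxB \<in> schemes L" "x \<in> designated" "x \<notin> {Vf2, Vt2}"
    and "y \<in> nimp x VF" "b \<in> nbox L y" "c \<in> nimp b VF"
  shows "c \<in> necessary"
proof -
  have "y \<in> {VF, Vf, Vf3}"
    using assms(2-4) by (cases x) (auto simp: designated_def)
  then have "b \<in> {VF, Vt3}"
    using assms(1,5) by (cases L) auto
  then show ?thesis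
    using assms(6) by (auto simp: necessary_def)
qed

text \<open>For axiom 4: the box tables then send every necessary value to \<open>VT\<close> or
  \<open>Vt2\<close>.\<close>

lemma necessary_box:
  assumes "Ax4 \<in> schemes L" "x \<in> necessary" "b \<in> nbox L x"
  shows "b \<in> necessary"
  using assms by (cases L; cases x) (auto simp: necessary_def)

text \<open>For axiom 5: \<open>VF\<close> is then the only undesignated output of the box table,
  and its negation is \<open>VT\<close>.\<close>

lemma necessary_neg_box:
  assumes "Ax5 \<in> schemes L" "b \<notin> designated" "b \<in> nbox L x" "c \<in> nimp b VF"
  shows "c \<in> necessary"
proof -
  have "b = VF"
    using assms(1-3) by (cases L; cases x) (auto simp: designated_def)
  then show ?thesis
    using assms(4) by (simp add: necessary_def)
qed

lemma designated_scheme_inst: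
  assumes v: "v \<in> levels L 0" and s: "s \<in> schemes L"
  shows "v (scheme_inst s \<alpha>) \<in> designated"
proof -
  have V: "v \<in> Val L"
    using v by (rule levels_zero_Val)
  note iffs = designated_imp_iff[OF V] designated_box_iff[OF V] not_designated_bot[OF V]
  show ?thesis
    using v
  proof (cases rule: levels_zero_cases)
    case collapsed
    then have "v \<beta> \<in> necessary" for \<beta>
      by (intro necessary_if_collapsed)
    \<comment> \<open>B, 4 and 5 have a boxed consequent, designated because every value is
      necessary; D and T are excluded.\<close>
    then show ?thesis
      using collapsed_vals[OF V collapsed] s by (cases s) (auto simp: iffs)
  next
    case regular
    have box: "v (\<^bold>\<box>\<beta>) \<in> nbox L (v \<beta>)" and val: "v \<beta> \<in> vals L" for \<beta>
      using V by (auto simp: Val_def)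
    have neg: "v (\<^bold>\<not>\<beta>) \<in> nimp (v \<beta>) VF" for \<beta>
    proof -
      have "v (\<^bold>\<not>\<beta>) \<in> nimp (v \<beta>) (v \<^bold>\<bottom>)"
        using V unfolding Val_def by blast
      then show ?thesis
        unfolding regular(2) .
    qed
    show ?thesis
    proof (cases s)
      case AxD
      have "v \<alpha> \<in> necessary \<Longrightarrow> v (\<^bold>\<not>\<alpha>) \<notin> necessary"
        by (rule not_necessary_neg[OF regular(1) neg])
      then show ?thesis
        by (simp add: AxD iffs)
    next
      case AxT
      have "v \<alpha> \<in> necessary \<Longrightarrow> v \<alpha> \<in> designated"
        using s unfolding AxT by (rule designated_if_necessary[OF _ val])
      then show ?thesis
        by (simp add: AxT iffs)
    next
      case AxB
      have "v \<alpha> \<in> designated \<Longrightarrow> v (\<^bold>\<diamond>\<alpha>) \<in> necessary"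
        using s unfolding AxB by (rule necessary_dia[OF _ _ regular(1) neg box neg])
      then show ?thesis
        by (simp add: AxB iffs)
    next
      case Ax4
      have "v \<alpha> \<in> necessary \<Longrightarrow> v (\<^bold>\<box>\<alpha>) \<in> necessary"
        using s unfolding Ax4 by (rule necessary_box[OF _ _ box])
      then show ?thesis
        by (simp add: Ax4 iffs)
    next
      case Ax5
      have "v (\<^bold>\<box>\<^bold>\<not>\<alpha>) \<notin> designated \<Longrightarrow> v (\<^bold>\<diamond>\<alpha>) \<in> necessary"
        using s unfolding Ax5 by (rule necessary_neg_box[OF _ _ box neg])
      then show ?thesis
        by (simp add: Ax5 iffs)
    qed
  qed
qed

lemma antimono_levels: "antimono (levels L)"
  by (rule antimono_iff_le_Suc[THEN iffD2]) auto

lemma levels_Val: "v \<in> levels L n \<Longrightarrow> v \<in> Val L"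
  using antimonoD[OF antimono_levels[of L], of 0 n] levels_zero_Val by blast

lemma thm_of_designated:
  "thm_of L \<alpha> \<Longrightarrow> \<exists>n. \<forall>v \<in> levels L n. v \<alpha> \<in> designated"
proof (induction rule: thm_of.induct)
  case (Ax_weak \<alpha> \<beta>)
  show ?case
    by (simp add: designated_imp_iff[OF levels_Val])
next
  case (Ax_dist \<alpha> \<beta> \<gamma>)
  show ?case
    by (simp add: designated_imp_iff[OF levels_Val])
next
  case (Ax_dneg \<alpha>)
  show ?case
    by (simp add: designated_imp_iff[OF levels_Val] not_designated_bot[OF levels_Val])
next
  case (Ax_k \<alpha> \<beta>)
  then show ?case
    using designated_k by blast
next
  case (Ax_scheme s \<alpha>)
  then show ?case
    using designated_scheme_inst by blast
next
  case (MP \<alpha> \<beta>)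
  then obtain m n where mn: "\<forall>v \<in> levels L m. v (\<alpha> \<^bold>\<rightarrow> \<beta>) \<in> designated"
    "\<forall>v \<in> levels L n. v \<alpha> \<in> designated"
    by blast
  \<comment> \<open>Levels shrink, so the later of the two satisfies both premises.\<close>
  have "v \<beta> \<in> designated" if v: "v \<in> levels L (max m n)" for v
  proof -
    have "v \<in> levels L m" "v \<in> levels L n"
      using v antimonoD[OF antimono_levels[of L]] max.cobounded1 max.cobounded2 by blast+
    then show ?thesis
      using mn designated_imp_iff[OF levels_Val[OF v]] by blast
  qed
  then show ?case by blast
next
  case (Nec \<alpha>)
  then obtain n where n: "\<forall>v \<in> levels L n. v \<alpha> \<in> designated"
    by blast
  have "v (\<^bold>\<box>\<alpha>) \<in> designated" if v: "v \<in> levels L (Suc n)" for v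
  proof -
    \<comment> \<open>Designation alone is too weak: \<open>Vt\<close> and \<open>Vt3\<close> have
      undesignated boxes. The next level rules them out.\<close>
    have "v \<alpha> \<in> {VT, Vt2}"
      using v n by simp
    then show ?thesis
      by (auto simp: designated_box_iff[OF levels_Val[OF v]] necessary_def)
  qed
  then show ?case by blast
qed

lemma designated_BigAnd:
  assumes "v \<in> Val L" and "\<forall>\<gamma> \<in> set \<gamma>s. v \<gamma> \<in> designated"
  shows "v (BigAnd \<gamma>s) \<in> designated"
  using assms(2)
  by (induction \<gamma>s rule: BigAnd.induct)
    (auto simp: designated_imp_iff[OF assms(1)] not_designated_bot[OF assms(1)])

theorem theorem1:
  fixes L :: logic and \<Gamma> :: "('p::countable) fm set" and \<alpha> :: "'p fm"
  assumes "derives L \<Gamma> \<alpha>"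
  shows "entails L \<Gamma> \<alpha>"
  unfolding entails_def
proof (intro ballI impI)
  fix v :: "'p fm \<Rightarrow> tv"
  assume v: "v \<in> level_vals L" and \<Gamma>: "\<forall>\<beta> \<in> \<Gamma>. v \<beta> \<in> designated"
  have level: "v \<in> levels L n" for n
    using v by (simp add: level_vals_def)
  \<comment> \<open>The level needed depends on the theorem, but \<open>v\<close> lies in all of
    them.\<close>
  have theorems: "v \<beta> \<in> designated" if "thm_of L \<beta>" for \<beta>
    using thm_of_designated[OF that] level by blast
  have V: "v \<in> Val L"
    using level by (rule levels_Val)
  show "v \<alpha> \<in> designated"
    using assms unfolding derives_def
  proof (elim disjE exE conjE)
    assume "thm_of L \<alpha>"
    then show ?thesis by (rule theorems)
  next
    fix \<gamma>s
    assume \<gamma>s: "set \<gamma>s \<subseteq> \<Gamma>" and imp: "thm_of L (BigAnd \<gamma>s \<^bold>\<rightarrow> \<alpha>)"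
    have "v (BigAnd \<gamma>s) \<in> designated"
      using \<gamma>s \<Gamma> by (intro designated_BigAnd[OF V]) blast
    then show ?thesis
      using theorems[OF imp] by (simp add: designated_imp_iff[OF V])
  qed
qed

end
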